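(* Let $\mathbb{F}$ be a field of characteristic zero, let $(\Gamma_n,\cdot)$ be the Grassmann superalgebra over $\mathbb{F}$ in generators $1,x_1,\dots,x_n$, and let $\mathcal{D}=\{d_1,\dots,d_n\}$ be a set of odd derivations of $\Gamma_n$ with $x_id_j=x_jd_i=a_{ij}\in(\Gamma_n)_{\bar0}$ for $i,j=1,\dots,n$, such that $\Gamma_n$ is differentiably simple with respect to $\mathcal{D}$. Let $f_1,\dots,f_n\in\Gamma_n$ and let $d=\sum_{k=1}^n\partial_kf_k$ be a homogeneous mapping. Then $d\in Der(\Gamma_n(\mathcal{D}))$ if and only if $$\sum_{k=1}^n a_{ij}\partial_k\cdot f_k=(-1)^d\sum_{k=1}^n\bigl(f_i\partial_k\cdot a_{jk}+f_j\partial_k\cdot a_{ik}\bigr)\qquad\text{for all } i,j\le n.$$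
   Context: Linear maps are written on the right, and a symbol in the exponent of $-1$ stands for its parity. A homogeneous linear map $d$ of a superalgebra is a derivation if $(xy)d=(-1)^{dy}(xd)y+x(yd)$ for all homogeneous $x,y$; $Der$ denotes the Lie superalgebra spanned by the even and odd derivations. $\partial_k$ is the odd derivation of $(\Gamma_n,\cdot)$ (in this sense) with $x_i\partial_k=\delta_{ik}$, and $d=\sum_k\partial_kf_k$ is the map $h\mapsto\sum_k(h\partial_k)\cdot f_k$, so $x_kd=f_k$. $(-1)^d$ is $1$ for $d$ even and $-1$ for $d$ odd. Differentiably simple with respect to $\mathcal{D}$ means that $\Gamma_n$ has no nonzero proper ideal invariant under all $d_1,\dots,d_n$. $[\,,]$ is the superanticommutative (generic) Poisson bracket on $(\Gamma_n,\cdot)$ determined by $[x_i,x_j]=x_id_j=a_{ij}$; i.e. it is bilinear, even, satisfies $[a,b]=-(-1)^{ab}[b,a]$ and $[a\cdot b,c]=(-1)^{bc}[a,c]\cdot b+a\cdot[b,c]$ for homogeneous $a,b,c$. $\Gamma_n(\mathcal{D})$ is the superspace $\Gamma_n$ with the multiplication $ab=a\cdot b+[a,b]$. *)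

theory Defs
  imports Complex_Main "HOL-Library.Z2"
begin

section \<open>The Grassmann algebra\<close>

text \<open>
  An element is given by its coordinates: \<open>coeff f S\<close> is the coefficient of the
  monomial \<open>x\<^sub>S = x\<^bsub>s\<^sub>1\<^esub> \<cdots> x\<^bsub>s\<^sub>m\<^esub>\<close>, where \<open>S = {s\<^sub>1 < \<dots> < s\<^sub>m}\<close>. The generators are indexed by
  a finite linearly ordered type \<open>'n\<close>, so that \<open>n = CARD('n)\<close>; the order only serves to
  fix the sign of each \<open>x\<^sub>S\<close>.
\<close>

typedef ('a, 'n) grassmann = "UNIV :: ('n set \<Rightarrow> 'a) set"
  morphisms coeff Grassmann ..

lemma coeff_Grassmann [simp]: "coeff (Grassmann c) = c"
  by (simp add: Grassmann_inverse)

lemma grassmann_eqI: "(\<And>S. coeff f S = coeff g S) \<Longrightarrow> f = g"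
  by (metis coeff_inverse ext)

definition inversions :: "'n::linorder set \<Rightarrow> 'n set \<Rightarrow> nat"
  where "inversions S T = card {(s, t). s \<in> S \<and> t \<in> T \<and> t < s}"

instantiation grassmann :: (comm_ring_1, "{finite, linorder}") ring_1
begin

definition "0 = Grassmann (\<lambda>_. 0)"
definition "1 = Grassmann (\<lambda>S. if S = {} then 1 else 0)"
definition "f + g = Grassmann (\<lambda>S. coeff f S + coeff g S)"
definition "- f = Grassmann (\<lambda>S. - coeff f S)"
definition "f - g = Grassmann (\<lambda>S. coeff f S - coeff g S)"

text \<open>For disjoint \<open>T\<close> and \<open>U\<close> we have \<open>x\<^sub>T x\<^sub>U = (-1)\<^bsup>inversions T U\<^esup> x\<^bsub>T \<union> U\<^esub>\<close>;
  otherwise \<open>x\<^sub>T x\<^sub>U = 0\<close>.\<close>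

definition
  "f * g = Grassmann (\<lambda>S. \<Sum>T\<in>Pow S. (- 1) ^ inversions T (S - T) * coeff f T * coeff g (S - T))"

lemma coeff_zero: "coeff 0 S = 0"
  and coeff_one: "coeff 1 S = (if S = {} then 1 else 0)"
  and coeff_add: "coeff (f + g) S = coeff f S + coeff g S"
  and coeff_uminus: "coeff (- f) S = - coeff f S"
  and coeff_diff: "coeff (f - g) S = coeff f S - coeff g S"
  and coeff_mult: "coeff (f * g) S =
    (\<Sum>T\<in>Pow S. (- 1) ^ inversions T (S - T) * coeff f T * coeff g (S - T))"
  for f g :: "('a, 'b) grassmann"
  by (simp_all add: zero_grassmann_def one_grassmann_def plus_grassmann_def
      uminus_grassmann_def minus_grassmann_def times_grassmann_def)

lemma inversions_Un_left:
  fixes S T U :: "'b set"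
  assumes "S \<inter> T = {}"
  shows "inversions (S \<union> T) U = inversions S U + inversions T U"
proof -
  have "{(s, t). s \<in> S \<union> T \<and> t \<in> U \<and> t < s} =
      {(s, t). s \<in> S \<and> t \<in> U \<and> t < s} \<union> {(s, t). s \<in> T \<and> t \<in> U \<and> t < s}"
    by auto
  then show ?thesis
    unfolding inversions_def using assms by (simp only:) (rule card_Un_disjoint; auto)
qed

lemma inversions_Un_right:
  fixes S T U :: "'b set"
  assumes "T \<inter> U = {}"
  shows "inversions S (T \<union> U) = inversions S T + inversions S U"
proof -
  have "{(s, t). s \<in> S \<and> t \<in> T \<union> U \<and> t < s} =
      {(s, t). s \<in> S \<and> t \<in> T \<and> t < s} \<union> {(s, t). s \<in> S \<and> t \<in> U \<and> t < s}"
    by auto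
  then show ?thesis
    unfolding inversions_def using assms by (simp only:) (rule card_Un_disjoint; auto)
qed

lemma inversions_empty [simp]: "inversions {} S = 0" "inversions S {} = 0"
  by (simp_all add: inversions_def)

instance
proof
  fix f g h :: "('a, 'b) grassmann"
  show "f * g * h = f * (g * h)"
  proof (rule grassmann_eqI)
    fix S :: "'b set"
    let ?e = "\<lambda>T U. (- 1) ^ inversions T U :: 'a"
    have "coeff (f * g * h) S = (\<Sum>U\<in>Pow S. \<Sum>T\<in>Pow U.
        ?e U (S - U) * ?e T (U - T) * coeff f T * coeff g (U - T) * coeff h (S - U))"
      by (simp add: coeff_mult sum_distrib_left sum_distrib_right mult.assoc)
    also have "\<dots> = (\<Sum>(U, T)\<in>Sigma (Pow S) Pow.
        ?e U (S - U) * ?e T (U - T) * coeff f T * coeff g (U - T) * coeff h (S - U))"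
      by (rule sum.Sigma) auto
    also have "\<dots> = (\<Sum>(T, V)\<in>Sigma (Pow S) (\<lambda>T. Pow (S - T)).
        ?e T (S - T) * ?e V (S - T - V) * coeff f T * coeff g V * coeff h (S - T - V))"
    proof (rule sum.reindex_bij_witness[where
          i = "\<lambda>(T, V). (T \<union> V, T)" and j = "\<lambda>(U, T). (T, U - T)"], goal_cases)
      case (5 p)
      then obtain U T where p: "p = (U, T)" "T \<subseteq> U" "U \<subseteq> S" by auto
      define V W where "V = U - T" and "W = S - U"
      have eqs: "U = T \<union> V" "S - T = V \<union> W" "S - T - V = W" "U - T = V" "S - U = W"
        "T \<inter> V = {}" "V \<inter> W = {}"
        using p by (auto simp: V_def W_def)
      have "?e U W * ?e T V = ?e T (V \<union> W) * ?e V W"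
        using eqs by (simp add: inversions_Un_left inversions_Un_right power_add mult.commute mult.left_commute)
      then show ?case
        using eqs p by simp
    qed auto
    also have "\<dots> = (\<Sum>T\<in>Pow S. \<Sum>V\<in>Pow (S - T).
        ?e T (S - T) * ?e V (S - T - V) * coeff f T * coeff g V * coeff h (S - T - V))"
      by (rule sum.Sigma [symmetric]) auto
    also have "\<dots> = coeff (f * (g * h)) S"
      by (simp add: coeff_mult sum_distrib_left sum_distrib_right mult_ac)
    finally show "coeff (f * g * h) S = coeff (f * (g * h)) S" .
  qed
  show "1 * f = f"
  proof (rule grassmann_eqI)
    fix S :: "'b set"
    have "coeff (1 * f) S =
        (\<Sum>T\<in>Pow S. if T = {} then coeff f S else 0)"
      unfolding coeff_mult coeff_one by (rule sum.cong) auto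
    then show "coeff (1 * f) S = coeff f S" by (simp add: sum.delta)
  qed
  show "f * 1 = f"
  proof (rule grassmann_eqI)
    fix S :: "'b set"
    have "coeff (f * 1) S =
        (\<Sum>T\<in>Pow S. if T = S then coeff f S else 0)"
      unfolding coeff_mult coeff_one by (rule sum.cong) auto
    then show "coeff (f * 1) S = coeff f S" by (simp add: sum.delta)
  qed
  have "coeff (0 :: ('a, 'b) grassmann) {} \<noteq> coeff 1 {}"
    by (simp add: coeff_zero coeff_one)
  then show "(0 :: ('a, 'b) grassmann) \<noteq> 1" by metis
qed (auto intro!: grassmann_eqI simp: coeff_zero coeff_add coeff_uminus coeff_diff coeff_mult
    algebra_simps sum.distrib)

end

definition gen :: "'n::{finite, linorder} \<Rightarrow> ('a::comm_ring_1, 'n) grassmann"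
  where "gen i = Grassmann (\<lambda>S. if S = {i} then 1 else 0)"

definition gscale :: "'a::comm_ring_1 \<Rightarrow> ('a, 'n::{finite, linorder}) grassmann \<Rightarrow> ('a, 'n) grassmann"
  where "gscale c f = Grassmann (\<lambda>S. c * coeff f S)"

lemma coeff_gscale: "coeff (gscale c f) S = c * coeff f S"
  by (simp add: gscale_def)

global_interpretation grassmann:
  vector_space "gscale :: 'a::field \<Rightarrow> ('a, 'n::{finite, linorder}) grassmann \<Rightarrow> _"
  by unfold_locales (auto intro!: grassmann_eqI simp: coeff_gscale coeff_add algebra_simps)

lemma gscale_mult_left: "gscale c f * g = gscale c (f * g)"
  by (rule grassmann_eqI) (simp add: coeff_mult coeff_gscale sum_distrib_left mult_ac)

lemma gscale_mult_right: "f * gscale c g = gscale c (f * g)"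
  by (rule grassmann_eqI) (simp add: coeff_mult coeff_gscale sum_distrib_left mult_ac)

lemma coeff_gen_mult:
  "coeff (gen i * gen j :: ('a::comm_ring_1, 'n::{finite, linorder}) grassmann) S =
    (if i \<noteq> j \<and> S = {i, j} then (if j < i then - 1 else 1) else 0)"
proof -
  have "coeff (gen i * gen j :: ('a, 'n) grassmann) S = (\<Sum>T\<in>Pow S.
      if T = {i} then (if S - {i} = {j} then (- 1) ^ inversions {i} {j} else 0) else 0)"
    unfolding coeff_mult gen_def coeff_Grassmann by (rule sum.cong) auto
  also have "\<dots> = (if i \<in> S \<and> S - {i} = {j} then (- 1) ^ inversions {i} {j} else 0)"
    by (simp add: sum.delta)
  also have "inversions {i} {j} = (if j < i then 1 else 0)"
  proof -
    have "{(s, t). s \<in> {i} \<and> t \<in> {j} \<and> t < s} = (if j < i then {(i, j)} else {})"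
      by auto
    then show ?thesis by (simp add: inversions_def)
  qed
  also have "i \<in> S \<and> S - {i} = {j} \<longleftrightarrow> i \<noteq> j \<and> S = {i, j}"
    by auto
  finally show ?thesis by simp
qed

lemma gen_mult_self: "gen i * gen i = 0"
  by (rule grassmann_eqI) (simp add: coeff_gen_mult coeff_zero)

lemma gen_anticommute: "gen i * gen j = - (gen j * gen i)"
  by (rule grassmann_eqI) (auto simp: coeff_gen_mult coeff_uminus insert_commute)


section \<open>Superalgebra structures on the Grassmann superspace\<close>

text \<open>Parities are elements of \<open>\<int>/2\<close>, represented by the type \<open>bit\<close>.\<close>

definition gpart :: "bit \<Rightarrow> ('a::comm_ring_1, 'n::{finite, linorder}) grassmann set"
  where "gpart p = {f. \<forall>S. coeff f S \<noteq> 0 \<longrightarrow> of_nat (card S) = p}"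

definition psign :: "bit \<Rightarrow> 'r::ring_1"
  where "psign p = (if p = 0 then 1 else - 1)"

definition homogeneous_map ::
    "bit \<Rightarrow> (('a::field, 'n::{finite, linorder}) grassmann \<Rightarrow> ('a, 'n) grassmann) \<Rightarrow> bool"
  where "homogeneous_map p d \<longleftrightarrow>
    Vector_Spaces.linear gscale gscale d \<and> (\<forall>q. \<forall>x\<in>gpart q. d x \<in> gpart (q + p))"

text \<open>
  The multiplication \<open>m\<close> is a parameter, since derivations are considered both for the
  Grassmann product and for its deformation by a bracket. The sign is the one that belongs
  to maps written on the right: \<open>d x\<close> stands for \<open>x d\<close>.
\<close>

definition derivation ::
    "(('a::field, 'n::{finite, linorder}) grassmann \<Rightarrow> ('a, 'n) grassmann \<Rightarrow> ('a, 'n) grassmann)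
      \<Rightarrow> bit \<Rightarrow> (('a, 'n) grassmann \<Rightarrow> ('a, 'n) grassmann) \<Rightarrow> bool"
  where "derivation m p d \<longleftrightarrow> homogeneous_map p d \<and>
    (\<forall>r q. \<forall>x\<in>gpart r. \<forall>y\<in>gpart q. d (m x y) = psign (p * q) * m (d x) y + m x (d y))"

text \<open>For bilinear \<open>m\<close> the even derivations and the odd derivations each form a subspace, so their
  span is the sum of the two.\<close>

definition Der ::
    "(('a::field, 'n::{finite, linorder}) grassmann \<Rightarrow> ('a, 'n) grassmann \<Rightarrow> ('a, 'n) grassmann)
      \<Rightarrow> (('a, 'n) grassmann \<Rightarrow> ('a, 'n) grassmann) set"
  where "Der m = {(\<lambda>x. d\<^sub>0 x + d\<^sub>1 x) | d\<^sub>0 d\<^sub>1. derivation m 0 d\<^sub>0 \<and> derivation m 1 d\<^sub>1}"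

definition gideal :: "('a::field, 'n::{finite, linorder}) grassmann set \<Rightarrow> bool"
  where "gideal I \<longleftrightarrow> grassmann.subspace I \<and> (\<forall>x\<in>I. \<forall>y. x * y \<in> I \<and> y * x \<in> I)"

definition differentiably_simple ::
    "('n \<Rightarrow> ('a::field, 'n::{finite, linorder}) grassmann \<Rightarrow> ('a, 'n) grassmann) \<Rightarrow> bool"
  where "differentiably_simple D \<longleftrightarrow>
    \<not> (\<exists>I. gideal I \<and> I \<noteq> {0} \<and> I \<noteq> UNIV \<and> (\<forall>i. \<forall>x\<in>I. D i x \<in> I))"

text \<open>Superanticommutative generic Poisson brackets; the Jacobi identity is not required.\<close>

definition poisson_bracket ::
    "(('a::field, 'n::{finite, linorder}) grassmann \<Rightarrow> ('a, 'n) grassmann \<Rightarrow> ('a, 'n) grassmann)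
      \<Rightarrow> bool"
  where "poisson_bracket br \<longleftrightarrow>
    (\<forall>a. Vector_Spaces.linear gscale gscale (br a)) \<and>
    (\<forall>b. Vector_Spaces.linear gscale gscale (\<lambda>a. br a b)) \<and>
    (\<forall>p q. \<forall>a\<in>gpart p. \<forall>b\<in>gpart q. br a b \<in> gpart (p + q)) \<and>
    (\<forall>p q. \<forall>a\<in>gpart p. \<forall>b\<in>gpart q. br a b = - (psign (p * q) * br b a)) \<and>
    (\<forall>p q r. \<forall>a\<in>gpart p. \<forall>b\<in>gpart q. \<forall>c\<in>gpart r.
      br (a * b) c = psign (q * r) * (br a c * b) + a * br b c)"

definition deformed_mult ::
    "(('a::field, 'n::{finite, linorder}) grassmann \<Rightarrow> ('a, 'n) grassmann \<Rightarrow> ('a, 'n) grassmann)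
      \<Rightarrow> ('a, 'n) grassmann \<Rightarrow> ('a, 'n) grassmann \<Rightarrow> ('a, 'n) grassmann"
  where "deformed_mult br a b = a * b + br a b"

end

theory Submission
  imports Defs
begin

text \<open>
  Both \<open>d\<close> and every \<open>x \<mapsto> [x, y]\<close> are derivations of the Grassmann product, so \<open>d\<close> is a derivation
  of the deformed product iff it is one of the bracket. The latter says that the supercommutator
  of \<open>[\<cdot>, y]\<close> with \<open>d\<close> equals \<open>[\<cdot>, yd]\<close>. These are derivations of equal parity,
  hence they agree as soon as they agree on the generators; by superanticommutativity
  it suffices to let \<open>y\<close> run through the generators too. On generators the condition is the displayed
  formula, because \<open>[\<cdot>, x\<^sub>j] = \<Sum>\<^sub>k \<partial>\<^sub>k a\<^bsub>kj\<^esub>\<close>.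
\<close>

section \<open>Parity\<close>

lemma psign_simps [simp]: "psign 0 = 1" "psign 1 = - 1"
  by (simp_all add: psign_def)

lemma psign_of_nat: "psign (of_nat n) = (- 1) ^ n"
  by (induction n) (auto simp: psign_def)

lemma coeff_psign_mult: "coeff (psign p * f) S = psign p * coeff f S"
  by (simp add: psign_def coeff_uminus)

lemma gpart_zero [simp]: "0 \<in> gpart p"
  by (simp add: gpart_def coeff_zero)

lemma gpart_add: "x \<in> gpart p \<Longrightarrow> y \<in> gpart p \<Longrightarrow> x + y \<in> gpart p"
  unfolding gpart_def coeff_add mem_Collect_eq by (metis add.right_neutral)

lemma gpart_uminus: "x \<in> gpart p \<Longrightarrow> - x \<in> gpart p"
  by (simp add: gpart_def coeff_uminus)

lemma gpart_diff: "x \<in> gpart p \<Longrightarrow> y \<in> gpart p \<Longrightarrow> x - y \<in> gpart p"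
  using gpart_add[of x p "- y"] gpart_uminus[of y p] by simp

lemma gpart_psign_mult: "x \<in> gpart p \<Longrightarrow> psign q * x \<in> gpart p"
  by (simp add: psign_def gpart_uminus)

lemma gpart_sum: "(\<And>k. k \<in> A \<Longrightarrow> x k \<in> gpart p) \<Longrightarrow> sum x A \<in> gpart p"
  by (induction A rule: infinite_finite_induct) (auto simp: gpart_add)

lemma gpart_one: "1 \<in> gpart 0"
  by (simp add: gpart_def coeff_one)

lemma gpart_gen: "gen i \<in> gpart 1"
  by (simp add: gpart_def gen_def)

text \<open>A non-zero coefficient at \<open>S\<close> needs a non-zero summand, that is a split of
  \<open>S\<close> into supports \<open>T\<close> and \<open>S - T\<close> whose cardinalities add
  up.\<close>

lemma gpart_mult:
  assumes "x \<in> gpart p" "y \<in> gpart q"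
  shows "x * y \<in> gpart (p + q)"
  unfolding gpart_def
proof (intro CollectI allI impI)
  fix S assume "coeff (x * y) S \<noteq> 0"
  then obtain T where T: "T \<subseteq> S" "coeff x T \<noteq> 0" "coeff y (S - T) \<noteq> 0"
    unfolding coeff_mult by (metis (no_types, lifting) PowD mult_zero_left mult_zero_right sum.neutral)
  have "card S = card T + card (S - T)"
    using T(1) by (simp add: card_Diff_subset card_mono)
  then have "(of_nat (card S) :: bit) = of_nat (card T) + of_nat (card (S - T))"
    by (metis of_nat_add)
  moreover have "of_nat (card T) = p" "of_nat (card (S - T)) = q"
    using T assms unfolding gpart_def by blast+
  ultimately show "of_nat (card S) = p + q"
    by (simp only:)
qed

lemma gpart_inter: "p \<noteq> q \<Longrightarrow> x \<in> gpart p \<Longrightarrow> x \<in> gpart q \<Longrightarrow> x = 0"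
  by (rule grassmann_eqI) (auto simp: gpart_def coeff_zero)

text \<open>Disjointness excludes \<open>s = t\<close>, so each pair of \<open>S \<times> T\<close>
  is counted by exactly one of the two inversion numbers.\<close>

lemma inversions_swap:
  assumes "S \<inter> T = {}"
  shows "inversions S T + inversions T S = card S * card (T :: 'n::{finite, linorder} set)"
proof -
  have "inversions T S = card {(s, t). s \<in> S \<and> t \<in> T \<and> s < t}"
    unfolding inversions_def
    by (rule bij_betw_same_card[of prod.swap]) (auto simp: bij_betw_def inj_on_def image_iff)
  then have "inversions S T + inversions T S
      = card ({(s, t). s \<in> S \<and> t \<in> T \<and> t < s} \<union> {(s, t). s \<in> S \<and> t \<in> T \<and> s < t})"
    unfolding inversions_def by (subst card_Un_disjoint) auto
  also have "{(s, t). s \<in> S \<and> t \<in> T \<and> t < s} \<union> {(s, t). s \<in> S \<and> t \<in> T \<and> s < t} = S \<times> T"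
    using assms by auto
  finally show ?thesis
    by (simp add: card_cartesian_product)
qed

text \<open>The summand for \<open>T\<close> in \<open>x * y\<close> is matched with the summand for
  the complement \<open>S - T\<close> in \<open>y * x\<close>. Where both coefficients are non-zero,
  the cardinalities have parities \<open>p\<close> and \<open>q\<close>, and
  \<open>inversions_swap\<close> yields the sign.\<close>

lemma supercommute:
  fixes x y :: "('a::comm_ring_1, 'n::{finite, linorder}) grassmann"
  assumes "x \<in> gpart p" "y \<in> gpart q"
  shows "x * y = psign (p * q) * (y * x)"
proof (rule grassmann_eqI)
  fix S :: "'n set"
  have term_eq: "(- 1) ^ inversions T (S - T) * coeff x T * coeff y (S - T) =
      psign (p * q) * ((- 1) ^ inversions (S - T) T * coeff y (S - T) * coeff x T)" for T
  proof (cases "coeff x T = 0 \<or> coeff y (S - T) = 0")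
    case False
    then have "of_nat (card T) = p" "of_nat (card (S - T)) = q"
      using assms unfolding gpart_def by blast+
    then have "(psign (p * q) :: 'a) = (- 1) ^ (card T * card (S - T))"
      by (metis of_nat_mult psign_of_nat)
    also have "\<dots> = (- 1) ^ (inversions T (S - T) + inversions (S - T) T)"
      by (subst inversions_swap) auto
    \<comment> \<open>The factor \<open>(- 1) ^ inversions (S - T) T\<close> squares to 1, so it can
      be moved to the other side.\<close>
    finally have "psign (p * q) * (- 1) ^ inversions (S - T) T = ((- 1) ^ inversions T (S - T) :: 'a)"
      by (simp add: power_add mult.assoc)
    from this[symmetric] show ?thesis
      by (simp only: mult_ac)
  qed auto
  have "coeff (x * y) S =
      (\<Sum>T\<in>Pow S. psign (p * q) * ((- 1) ^ inversions (S - T) T * coeff y (S - T) * coeff x T))"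
    unfolding coeff_mult by (rule sum.cong) (simp_all only: term_eq)
  also have "\<dots> =
      (\<Sum>T\<in>Pow S. psign (p * q) * ((- 1) ^ inversions T (S - T) * coeff y T * coeff x (S - T)))"
    by (rule sum.reindex_bij_witness[where i = "\<lambda>T. S - T" and j = "\<lambda>T. S - T"])
      (auto simp: double_diff)
  finally show "coeff (x * y) S = coeff (psign (p * q) * (y * x)) S"
    unfolding coeff_psign_mult by (simp only: coeff_mult[of y x] sum_distrib_left)
qed


section \<open>Induction principles\<close>

definition monomial :: "'n set \<Rightarrow> ('a::comm_ring_1, 'n::{finite, linorder}) grassmann"
  where "monomial S = Grassmann (\<lambda>T. if T = S then 1 else 0)"

lemma monomial_empty: "monomial {} = 1"
  by (simp add: monomial_def one_grassmann_def)

text \<open>A smallest generator placed on the left creates no inversions, hence no sign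
  appears.\<close>

lemma monomial_insert:
  fixes A :: "'n::{finite, linorder} set"
  assumes "\<And>a. a \<in> A \<Longrightarrow> b < a"
  shows "(monomial (insert b A) :: ('a::comm_ring_1, 'n) grassmann) = gen b * monomial A"
proof (rule grassmann_eqI)
  fix S :: "'n set"
  have b: "b \<notin> A" using assms by blast
  have "{(s, t). s \<in> {b} \<and> t \<in> A \<and> t < s} = {}"
    using assms by (auto dest: less_asym)
  then have inv: "inversions {b} A = 0"
    by (simp add: inversions_def)
  have "coeff (gen b * monomial A :: ('a, 'n) grassmann) S =
      (\<Sum>T\<in>Pow S. if T = {b} then if S - {b} = A then 1 else 0 else 0)"
    unfolding coeff_mult gen_def monomial_def coeff_Grassmann
    by (rule sum.cong) (auto simp: inv)
  also have "\<dots> = (if b \<in> S \<and> S - {b} = A then 1 else 0)"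
    by (simp add: sum.delta)
  also have "b \<in> S \<and> S - {b} = A \<longleftrightarrow> S = insert b A"
    using b by auto
  finally show "coeff (monomial (insert b A) :: ('a, 'n) grassmann) S = coeff (gen b * monomial A) S"
    by (simp add: monomial_def)
qed

lemma gpart_monomial: "monomial S \<in> gpart (of_nat (card S))"
  by (simp add: gpart_def monomial_def)

lemma coeff_sum: "coeff (sum x A) S = (\<Sum>k\<in>A. coeff (x k) S)"
  by (induction A rule: infinite_finite_induct) (auto simp: coeff_zero coeff_add)

lemma sum_monomials: "(\<Sum>S\<in>UNIV. gscale (coeff x S) (monomial S)) = x"
proof (rule grassmann_eqI)
  fix T
  have "coeff (\<Sum>S\<in>UNIV. gscale (coeff x S) (monomial S)) T
      = (\<Sum>S\<in>UNIV. if T = S then coeff x S else 0)"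
    unfolding coeff_sum coeff_gscale monomial_def coeff_Grassmann by (rule sum.cong) auto
  then show "coeff (\<Sum>S\<in>UNIV. gscale (coeff x S) (monomial S)) T = coeff x T"
    by simp
qed

text \<open>Monomials arise from 1 by multiplying generators on the left in decreasing order, and
  they span the algebra. The factor \<open>y\<close> is kept homogeneous because the Leibniz rule
  speaks only of homogeneous factors.\<close>

lemma grassmann_induct [case_names one gen_mult add scale]:
  fixes x :: "('a::comm_ring_1, 'n::{finite, linorder}) grassmann"
  assumes one: "P 1"
    and gen_mult: "\<And>i q y. y \<in> gpart q \<Longrightarrow> P y \<Longrightarrow> P (gen i * y)"
    and add: "\<And>y z. P y \<Longrightarrow> P z \<Longrightarrow> P (y + z)"
    and scale: "\<And>c y. P y \<Longrightarrow> P (gscale c y)"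
  shows "P x"
proof -
  have "finite S \<Longrightarrow> P (monomial S)" for S :: "'n set"
  proof (induction S rule: finite_linorder_min_induct)
    case (insert b A)
    then show ?case
      using gen_mult[OF gpart_monomial] by (simp add: monomial_insert)
  qed (simp add: monomial_empty one)
  then have P_mono: "P (gscale c (monomial S))" for c and S :: "'n set"
    by (simp add: scale)
  \<comment> \<open>Zero starts the induction over sums of monomials; it is obtained as a multiple
    of 1.\<close>
  have "gscale 0 1 = (0 :: ('a, 'n) grassmann)"
    by (rule grassmann_eqI) (simp add: coeff_gscale coeff_zero)
  then have "P 0"
    using scale[OF one, of 0] by simp
  then have "P (\<Sum>S\<in>A. gscale (coeff x S) (monomial S))" for A
    by (induction A rule: infinite_finite_induct) (auto intro: add P_mono)
  then show ?thesis
    by (metis sum_monomials)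
qed

section \<open>Homogeneous linear maps\<close>

lemma linear_gscaleI:
  assumes "\<And>x y. h (x + y) = h x + h y" "\<And>c x. h (gscale c x) = gscale c (h x)"
  shows "Vector_Spaces.linear gscale gscale h"
  using assms by unfold_locales

lemma homogeneous_mapD:
  assumes "homogeneous_map p h"
  shows "h (x + y) = h x + h y" "h (gscale c x) = gscale c (h x)" "h 0 = 0" "h (- x) = - h x"
    "h (x - y) = h x - h y" "h (psign r * x) = psign r * h x" "x \<in> gpart q \<Longrightarrow> h x \<in> gpart (q + p)"
proof -
  interpret Vector_Spaces.linear gscale gscale h
    using assms by (simp add: homogeneous_map_def)
  show "h (x + y) = h x + h y" "h (gscale c x) = gscale c (h x)" "h 0 = 0" "h (- x) = - h x"
    "h (x - y) = h x - h y" "h (psign r * x) = psign r * h x"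
    by (simp_all add: add scale zero neg diff psign_def)
  show "x \<in> gpart q \<Longrightarrow> h x \<in> gpart (q + p)"
    using assms by (simp add: homogeneous_map_def)
qed

text \<open>Homogeneous elements span: 1 and the products in the induction are homogeneous, and
  linearity does the rest.\<close>

lemma homogeneous_map_eqI:
  assumes "homogeneous_map p g" "homogeneous_map q h"
    and "\<And>r x. x \<in> gpart r \<Longrightarrow> g x = h x"
  shows "g = h"
proof
  fix x show "g x = h x"
  proof (induction x rule: grassmann_induct)
    case one show ?case using assms(3) gpart_one by blast
  next
    case (gen_mult i r y) show ?case using assms(3) gpart_mult[OF gpart_gen gen_mult(1)] by blast
  qed (simp_all add: homogeneous_mapD[OF assms(1)] homogeneous_mapD[OF assms(2)])
qed


section \<open>Derivations of the Grassmann product\<close>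

lemma derivationI:
  assumes "\<And>x y. h (x + y) = h x + h y" "\<And>c x. h (gscale c x) = gscale c (h x)"
    and "\<And>q x. x \<in> gpart q \<Longrightarrow> h x \<in> gpart (q + p)"
    and "\<And>r q x y. x \<in> gpart r \<Longrightarrow> y \<in> gpart q \<Longrightarrow> h (m x y) = psign (p * q) * m (h x) y + m x (h y)"
  shows "derivation m p h"
  using assms linear_gscaleI[of h] by (auto simp: derivation_def homogeneous_map_def)

lemma derivation_homogeneous: "derivation m p h \<Longrightarrow> homogeneous_map p h"
  by (simp add: derivation_def)

lemma derivation_mult:
  "derivation m p h \<Longrightarrow> x \<in> gpart r \<Longrightarrow> y \<in> gpart q \<Longrightarrow>
    h (m x y) = psign (p * q) * m (h x) y + m x (h y)"
  by (auto simp: derivation_def)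

lemma derivation_one:
  assumes "derivation (*) p h"
  shows "h 1 = 0"
  using derivation_mult[OF assms gpart_one gpart_one] by simp

text \<open>The Leibniz rule determines the value at \<open>gen i * y\<close> from those at
  \<open>gen i\<close> and \<open>y\<close>. Equal parity of \<open>g\<close> and \<open>h\<close>
  makes the signs in the two rules coincide.\<close>

lemma derivation_eqI:
  assumes g: "derivation (*) p g" and h: "derivation (*) p h"
    and gen: "\<And>i. g (gen i) = h (gen i)"
  shows "g x = h x"
proof (induction x rule: grassmann_induct)
  case one show ?case by (simp add: derivation_one[OF g] derivation_one[OF h])
next
  case (gen_mult i q y)
  then show ?case
    by (simp add: derivation_mult[OF g gpart_gen] derivation_mult[OF h gpart_gen] gen)
qed (simp_all add: homogeneous_mapD[OF derivation_homogeneous[OF g]]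
    homogeneous_mapD[OF derivation_homogeneous[OF h]])

text \<open>Moving \<open>c\<close> past \<open>y\<close> costs \<open>psign (q * s)\<close>, which
  is just what changes the Leibniz sign from parity \<open>p\<close> to \<open>p + s\<close>. This
  applies to the summands \<open>pd k x * f k\<close> and \<open>pd k x * a j k\<close>.\<close>

lemma derivation_times_right:
  assumes h: "derivation (*) p h" and c: "c \<in> gpart s"
  shows "derivation (*) (p + s) (\<lambda>x. h x * c)"
proof (rule derivationI)
  note hm = homogeneous_mapD[OF derivation_homogeneous[OF h]]
  show "h (x + y) * c = h x * c + h y * c" for x y
    by (simp add: hm distrib_right)
  show "h (gscale k x) * c = gscale k (h x * c)" for k x
    by (simp add: hm gscale_mult_left)
  show "h x * c \<in> gpart (q + (p + s))" if "x \<in> gpart q" for q x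
    using gpart_mult[OF hm(7)[OF that] c] by (simp only: add.assoc)
  show "h (x * y) * c = psign ((p + s) * q) * (h x * c * y) + x * (h y * c)"
    if "x \<in> gpart r" "y \<in> gpart q" for r q x y
  proof -
    have "h (x * y) * c = psign (p * q) * (h x * (y * c)) + x * (h y * c)"
      by (simp add: derivation_mult[OF h that] distrib_right mult.assoc)
    also have "y * c = psign (q * s) * (c * y)"
      by (rule supercommute[OF that(2) c])
    finally show ?thesis
      by (cases p; cases q; cases s) (simp_all add: mult.assoc)
  qed
qed

lemma derivation_sum:
  assumes "\<And>k. k \<in> A \<Longrightarrow> derivation (*) p (h k)"
  shows "derivation (*) p (\<lambda>x. \<Sum>k\<in>A. h k x)"
proof (rule derivationI)
  note hm = homogeneous_mapD[OF derivation_homogeneous[OF assms]]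
  show "(\<Sum>k\<in>A. h k (x + y)) = (\<Sum>k\<in>A. h k x) + (\<Sum>k\<in>A. h k y)" for x y
    by (simp add: hm sum.distrib)
  show "(\<Sum>k\<in>A. h k (gscale c x)) = gscale c (\<Sum>k\<in>A. h k x)" for c x
    by (simp add: hm grassmann.scale_sum_right)
  show "(\<Sum>k\<in>A. h k x) \<in> gpart (q + p)" if "x \<in> gpart q" for q x
    using that by (intro gpart_sum hm)
  show "(\<Sum>k\<in>A. h k (x * y)) = psign (p * q) * ((\<Sum>k\<in>A. h k x) * y) + x * (\<Sum>k\<in>A. h k y)"
    if "x \<in> gpart r" "y \<in> gpart q" for r q x y
    using that
    by (simp add: derivation_mult[OF assms] sum.distrib sum_distrib_left sum_distrib_right)
qed

text \<open>With maps on the right this is the composite hg minus the signed gh. In the expansion at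
  \<open>x * y\<close> the mixed terms \<open>h x * g y\<close> and \<open>g x * h y\<close> each
  occur twice and cancel.\<close>

lemma derivation_supercommutator:
  assumes g: "derivation (*) p g" and h: "derivation (*) q h"
  shows "derivation (*) (p + q) (\<lambda>x. g (h x) - psign (p * q) * h (g x))"
proof (rule derivationI)
  note gm = homogeneous_mapD[OF derivation_homogeneous[OF g]]
  note hm = homogeneous_mapD[OF derivation_homogeneous[OF h]]
  show "g (h (x + y)) - psign (p * q) * h (g (x + y)) =
      g (h x) - psign (p * q) * h (g x) + (g (h y) - psign (p * q) * h (g y))" for x y
    by (simp add: gm hm algebra_simps)
  show "g (h (gscale c x)) - psign (p * q) * h (g (gscale c x)) =
      gscale c (g (h x) - psign (p * q) * h (g x))" for c x
    by (simp add: gm hm gscale_mult_right grassmann.scale_right_diff_distrib)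
  show "g (h x) - psign (p * q) * h (g x) \<in> gpart (r + (p + q))" if "x \<in> gpart r" for r x
    using gm(7)[OF hm(7)[OF that]] hm(7)[OF gm(7)[OF that]]
    by (intro gpart_diff gpart_psign_mult) (simp_all only: ac_simps)
  show "g (h (x * y)) - psign (p * q) * h (g (x * y)) =
      psign ((p + q) * s) * ((g (h x) - psign (p * q) * h (g x)) * y)
      + x * (g (h y) - psign (p * q) * h (g y))"
    if "x \<in> gpart r" "y \<in> gpart s" for r s x y
    unfolding derivation_mult[OF g that] derivation_mult[OF h that] gm hm
      derivation_mult[OF g hm(7)[OF that(1)] that(2)] derivation_mult[OF g that(1) hm(7)[OF that(2)]]
      derivation_mult[OF h gm(7)[OF that(1)] that(2)] derivation_mult[OF h that(1) gm(7)[OF that(2)]]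
    by (cases p; cases q; cases s) (simp_all add: algebra_simps)
qed


section \<open>Derivations and Poisson brackets\<close>

lemma poisson_bracketD:
  assumes "poisson_bracket br"
  shows "x \<in> gpart p \<Longrightarrow> y \<in> gpart q \<Longrightarrow> br x y = - (psign (p * q) * br y x)"
    and "y \<in> gpart q \<Longrightarrow> derivation (*) q (\<lambda>x. br x y)"
proof -
  have lin: "\<And>y. Vector_Spaces.linear gscale gscale (\<lambda>x. br x y)"
    and hom: "\<And>p q x y. x \<in> gpart p \<Longrightarrow> y \<in> gpart q \<Longrightarrow> br x y \<in> gpart (p + q)"
    and leib: "\<And>p q r x y z. x \<in> gpart p \<Longrightarrow> y \<in> gpart q \<Longrightarrow> z \<in> gpart r \<Longrightarrow>
      br (x * y) z = psign (q * r) * (br x z * y) + x * br y z"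
    using assms unfolding poisson_bracket_def by blast+
  show "x \<in> gpart p \<Longrightarrow> y \<in> gpart q \<Longrightarrow> br x y = - (psign (p * q) * br y x)"
    using assms unfolding poisson_bracket_def by blast
  show "derivation (*) q (\<lambda>x. br x y)" if "y \<in> gpart q"
    using lin[of y] hom[OF _ that] leib[OF _ _ that]
    by (simp add: derivation_def homogeneous_map_def mult.commute)
qed

lemma poisson_bracket_zero:
  assumes "poisson_bracket br"
  shows "br 0 x = 0" "br x 0 = 0"
proof -
  interpret left: Vector_Spaces.linear gscale gscale "\<lambda>y. br y x"
    using assms unfolding poisson_bracket_def by blast
  interpret right: Vector_Spaces.linear gscale gscale "br x"
    using assms unfolding poisson_bracket_def by blast
  show "br 0 x = 0" "br x 0 = 0"
    by (rule left.zero, rule right.zero)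
qed

text \<open>Superanticommutativity is applied to all three brackets; the parity cases check the
  signs. This transfers a result on the left argument to the right one.\<close>

lemma bracket_Leibniz_swap:
  assumes br: "poisson_bracket br" and d: "homogeneous_map p d"
    and x: "x \<in> gpart r" and y: "y \<in> gpart q"
    and eq: "d (br x y) = psign (p * q) * br (d x) y + br x (d y)"
  shows "d (br y x) = psign (p * r) * br (d y) x + br y (d x)"
proof -
  note dm = homogeneous_mapD[OF d]
  note anti = poisson_bracketD(1)[OF br]
  show ?thesis
    unfolding anti[OF y x] anti[OF dm(7)[OF y] x] anti[OF y dm(7)[OF x]] dm eq
    by (cases p; cases q; cases r) (simp_all add: algebra_simps)
qed

text \<open>For fixed \<open>y\<close> the claim equates two derivations in \<open>x\<close> of
  parity \<open>p + q\<close>: the supercommutator of \<open>d\<close> with \<open>br _ y\<close>,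
  and \<open>br _ (d y)\<close>. So \<open>x\<close> may be of mixed parity.\<close>

lemma bracket_Leibniz_if_gen_left:
  assumes br: "poisson_bracket br" and d: "derivation (*) p d" and y: "y \<in> gpart q"
    and gen: "\<And>i. d (br (gen i) y) = psign (p * q) * br (d (gen i)) y + br (gen i) (d y)"
  shows "d (br x y) = psign (p * q) * br (d x) y + br x (d y)"
proof -
  have dy: "d y \<in> gpart (p + q)"
    using homogeneous_mapD(7)[OF derivation_homogeneous[OF d] y] by (simp only: add.commute)
  have "d (br x y) - psign (p * q) * br (d x) y = br x (d y)"
    by (rule derivation_eqI[OF derivation_supercommutator[OF d poisson_bracketD(2)[OF br y]]
          poisson_bracketD(2)[OF br dy]]) (simp add: gen)
  then show ?thesis
    by (simp add: algebra_simps)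
qed

lemma derivation_bracket_iff:
  assumes br: "poisson_bracket br" and d: "derivation (*) p d"
  shows "derivation br p d \<longleftrightarrow>
    (\<forall>i j. d (br (gen i) (gen j)) = psign p * br (d (gen i)) (gen j) + br (gen i) (d (gen j)))"
    (is "_ \<longleftrightarrow> ?gens")
proof
  assume "derivation br p d"
  from derivation_mult[OF this gpart_gen gpart_gen] show ?gens
    by simp
next
  assume ?gens
  note d_hom = derivation_homogeneous[OF d]
  \<comment> \<open>First extension: the left argument becomes arbitrary while the right one is
    still a generator.\<close>
  have "d (br x (gen j)) = psign (p * 1) * br (d x) (gen j) + br x (d (gen j))" for x j
    by (rule bracket_Leibniz_if_gen_left[OF br d gpart_gen]) (simp add: \<open>?gens\<close>[rule_format])
  \<comment> \<open>After the swap the generator stands on the left and \<open>y\<close> is any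
    homogeneous element, as a second extension of the left argument requires.\<close>
  then have "d (br (gen j) y) = psign (p * q) * br (d (gen j)) y + br (gen j) (d y)"
    if "y \<in> gpart q" for j q y
    using bracket_Leibniz_swap[OF br d_hom that gpart_gen] by blast
  then have "d (br x y) = psign (p * q) * br (d x) y + br x (d y)" if "y \<in> gpart q" for q x y
    using bracket_Leibniz_if_gen_left[OF br d that] that by blast
  then show "derivation br p d"
    using d_hom unfolding derivation_def by blast
qed

section \<open>From the bracket to the deformed product and \<open>Der\<close>\<close>

lemma derivation_deformed_mult_iff:
  assumes d: "derivation (*) p d"
  shows "derivation (deformed_mult br) p d \<longleftrightarrow> derivation br p d"
proof -
  have "d (deformed_mult br x y) =
      psign (p * q) * deformed_mult br (d x) y + deformed_mult br x (d y) \<longleftrightarrow>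
      d (br x y) = psign (p * q) * br (d x) y + br x (d y)"
    if "x \<in> gpart r" "y \<in> gpart q" for r q x y
    by (simp add: deformed_mult_def homogeneous_mapD[OF derivation_homogeneous[OF d]]
        derivation_mult[OF d that] algebra_simps)
  then show ?thesis
    by (auto simp: derivation_def)
qed

text \<open>In a decomposition of \<open>d\<close> into an even and an odd derivation, the component
  of the wrong parity maps homogeneous elements into both parities at once, hence to 0.\<close>

lemma Der_homogeneous_iff:
  assumes d: "homogeneous_map p d"
    and m: "\<And>x. m 0 x = 0" "\<And>x. m x 0 = 0"
  shows "d \<in> Der m \<longleftrightarrow> derivation m p d"
proof
  \<comment> \<open>The zero map serves as the component of the other parity.\<close>
  have zero: "derivation m q (\<lambda>x. 0)" for q
    by (rule derivationI) (simp_all add: m)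
  assume "derivation m p d"
  then show "d \<in> Der m"
    using zero by (cases p) (force simp: Der_def)+
next
  assume "d \<in> Der m"
  then obtain d0 d1 where d_eq: "d = (\<lambda>x. d0 x + d1 x)"
    and d0: "derivation m 0 d0" and d1: "derivation m 1 d1"
    by (auto simp: Der_def)
  note hom = derivation_homogeneous[OF d0] derivation_homogeneous[OF d1]
  have parts: "d0 x \<in> gpart q" "d1 x \<in> gpart (q + 1)" "d x \<in> gpart (q + p)"
    if "x \<in> gpart q" for q x
    using homogeneous_mapD(7)[OF hom(1) that] homogeneous_mapD(7)[OF hom(2) that]
      homogeneous_mapD(7)[OF d that] by (simp_all only: add_0_right)
  have ne: "q + 1 \<noteq> q" for q :: bit
    by (cases q) simp_all
  show "derivation m p d"
  proof (cases p)
    case zero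
    have "d x = d0 x" if "x \<in> gpart q" for q x
    proof -
      have "d x - d0 x \<in> gpart q"
        using gpart_diff[OF _ parts(1)[OF that]] parts(3)[OF that] by (simp only: zero add_0_right)
      then have "d1 x \<in> gpart q"
        by (simp add: d_eq)
      then show ?thesis
        using gpart_inter[OF ne parts(2)[OF that]] by (simp add: d_eq)
    qed
    then have "d = d0"
      by (rule homogeneous_map_eqI[OF d hom(1)])
    then show ?thesis using d0 zero by simp
  next
    case one
    have "d x = d1 x" if "x \<in> gpart q" for q x
    proof -
      have "d x - d1 x \<in> gpart (q + 1)"
        using gpart_diff[OF _ parts(2)[OF that]] parts(3)[OF that] by (simp only: one)
      then have "d0 x \<in> gpart (q + 1)"
        by (simp add: d_eq)
      then show ?thesis
        using gpart_inter[OF ne _ parts(1)[OF that]] by (simp add: d_eq)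
    qed
    then have "d = d1"
      by (rule homogeneous_map_eqI[OF d hom(2)])
    then show ?thesis using d1 one by simp
  qed
qed

section \<open>Evaluation of the criterion on generators\<close>

theorem lemma13:
  fixes D pd :: "'n::{finite, linorder} \<Rightarrow> ('a::field_char_0, 'n) grassmann \<Rightarrow> ('a, 'n) grassmann"
    and a :: "'n \<Rightarrow> 'n \<Rightarrow> ('a, 'n) grassmann"
    and br :: "('a, 'n) grassmann \<Rightarrow> ('a, 'n) grassmann \<Rightarrow> ('a, 'n) grassmann"
    and f :: "'n \<Rightarrow> ('a, 'n) grassmann"
    and d :: "('a, 'n) grassmann \<Rightarrow> ('a, 'n) grassmann"
    and p :: bit
  assumes D_odd: "\<And>j. derivation (*) 1 (D j)"
    and D_gen: "\<And>i j. D j (gen i) = a i j" "\<And>i j. D i (gen j) = a i j"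
    and a_even: "\<And>i j. a i j \<in> gpart 0"
    and D_simple: "differentiably_simple D"
    and br: "poisson_bracket br"
    and br_gen: "\<And>i j. br (gen i) (gen j) = a i j"
    and pd_odd: "\<And>k. derivation (*) 1 (pd k)"
    and pd_gen: "\<And>i k. pd k (gen i) = (if i = k then 1 else 0)"
    and d_eq: "d = (\<lambda>h. \<Sum>k\<in>UNIV. pd k h * f k)"
    and d_homogeneous: "homogeneous_map p d"
  shows "d \<in> Der (deformed_mult br) \<longleftrightarrow>
    (\<forall>i j. (\<Sum>k\<in>UNIV. pd k (a i j) * f k) =
      psign p * (\<Sum>k\<in>UNIV. pd k (f i) * a j k + pd k (f j) * a i k))"
proof -
  have d_gen: "d (gen i) = f i" for i
    unfolding d_eq pd_gen by (simp add: if_distrib[of "\<lambda>x. x * _"] cong: if_cong)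
  \<comment> \<open>The parity of \<open>f i\<close> is read off from \<open>d\<close> at the odd
    element \<open>gen i\<close>.\<close>
  have f_gpart: "f i \<in> gpart (1 + p)" for i
    using homogeneous_mapD(7)[OF d_homogeneous gpart_gen] by (simp add: d_gen)
  have d_der: "derivation (*) p d"
    unfolding d_eq
  proof (rule derivation_sum)
    \<comment> \<open>The odd \<open>pd k\<close> times \<open>f k\<close> of parity
      \<open>1 + p\<close> has parity \<open>p\<close>, since \<open>1 + 1 = 0\<close> in
      \<open>bit\<close>.\<close>
    have "1 + (1 + p) = p"
      by (cases p) simp_all
    then show "derivation (*) p (\<lambda>x. pd k x * f k)" for k
      using derivation_times_right[OF pd_odd f_gpart, of k k] by (simp only:)
  qed
  \<comment> \<open>The two assumptions on \<open>D\<close> evaluate \<open>D i (gen j)\<close> as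
    \<open>a i j\<close> and as \<open>a j i\<close>.\<close>
  have a_sym: "a i j = a j i" for i j
    by (rule trans[OF D_gen(2)[symmetric] D_gen(1)])
  have br_gen_right: "br x (gen j) = (\<Sum>k\<in>UNIV. pd k x * a j k)" for x j
  proof (rule derivation_eqI[where g = "\<lambda>x. br x (gen j)"])
    show "derivation (*) 1 (\<lambda>x. br x (gen j))"
      by (rule poisson_bracketD(2)[OF br gpart_gen])
    show "derivation (*) 1 (\<lambda>x. \<Sum>k\<in>UNIV. pd k x * a j k)"
    proof (rule derivation_sum)
      show "derivation (*) 1 (\<lambda>x. pd k x * a j k)" for k
        using derivation_times_right[OF pd_odd a_even, of k j k] by simp
    qed
    \<comment> \<open>Only \<open>k = i\<close> survives and leaves \<open>a j i\<close>, which is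
      why the symmetry of \<open>a\<close> enters.\<close>
    show "br (gen i) (gen j) = (\<Sum>k\<in>UNIV. pd k (gen i) * a j k)" for i
      unfolding br_gen pd_gen a_sym[of i j]
      by (simp add: if_distrib[of "\<lambda>x. x * _"] cong: if_cong)
  qed
  \<comment> \<open>The parities are \<open>1\<close> and \<open>1 + p\<close>, so anticommutation
    contributes \<open>- psign (1 + p) = psign p\<close>.\<close>
  have br_gen_left: "br (gen i) (f j) = psign p * (\<Sum>k\<in>UNIV. pd k (f j) * a i k)" for i j
    unfolding br_gen_right[symmetric] poisson_bracketD(1)[OF br gpart_gen f_gpart]
    by (cases p) simp_all
  have "d \<in> Der (deformed_mult br) \<longleftrightarrow> derivation (deformed_mult br) p d"
    by (intro Der_homogeneous_iff[OF d_homogeneous])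
      (simp_all add: deformed_mult_def poisson_bracket_zero[OF br])
  also have "\<dots> \<longleftrightarrow> derivation br p d"
    by (rule derivation_deformed_mult_iff[OF d_der])
  also have "\<dots> \<longleftrightarrow> (\<forall>i j. d (a i j) = psign p * br (f i) (gen j) + br (gen i) (f j))"
    by (simp add: derivation_bracket_iff[OF br d_der] br_gen d_gen)
  \<comment> \<open>One \<open>psign p\<close> comes from the Leibniz rule and the other from
    \<open>br_gen_left\<close>, so the sign factors out of both sums.\<close>
  also have "\<dots> \<longleftrightarrow> (\<forall>i j. (\<Sum>k\<in>UNIV. pd k (a i j) * f k) =
      psign p * (\<Sum>k\<in>UNIV. pd k (f i) * a j k + pd k (f j) * a i k))"
    by (simp add: d_eq br_gen_right br_gen_left sum.distrib distrib_left)
  finally show ?thesis .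
qed

end
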